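(* The sets $\mathcal{M}(w)$, for $w$ running over reduced Motzkin words, are pairwise disjoint, and for any natural $n$ there is a natural bijection $${\rm NC}(n)\cong\bigcup_{w\in\mathcal{M}_n}\mathcal{M}(w)$$ (whose inverse forgets the words attached to the blocks). The same holds for the sets ${\rm NC}_{\rm irr}(n)$ and $\mathcal{M}_{\rm irr}(w)$. Moreover, $$C_n=\sum_{w\in\mathcal{M}_{n+1}}c(w),$$ where $C_n=\frac{1}{n+1}\binom{2n}{n}$ is the $n$th Catalan number and $c(w)=|\mathcal{M}_{\rm irr}(w)|$ for $w\in\mathcal{M}_{n+1}$.
   Context: **Motzkin words.** $\mathbb{N}=\{1,2,\dots\}$. $\mathcal{M}_n$ is the set of reduced Motzkin words of length $n$, i.e. words $w=j_1\cdots j_n$ in letters from $\mathbb{N}$ with $j_1=j_n=1$ and $|j_k-j_{k-1}|\in\{0,1\}$ for $1<k\le n$. **Noncrossing partitions.** ${\rm NC}(n)$ is the set of noncrossing partitions of $[n]=\{1,\dots,n\}$. For $\pi_0\in{\rm NC}(n)$, a block $V_j$ is an outer block of a block $V_i\neq V_j$ if there are $p,q\in V_j$ with $p<k<q$ for all $k\in V_i$. A block with no outer blocks is a covering block. If $V_i$ is not covering, its nearest outer block $o(V_i)$ is the unique outer block $V_j$ of $V_i$ such that no block $V_k$ is both an outer block of $V_i$ and has $V_j$ as an outer block. The depth $d(V)$ is $1$ for covering blocks, and $d(V)=d(o(V))+1$ otherwise. $\pi_0$ is irreducible if it has exactly one covering block; ${\rm NC}_{\rm irr}(n)$ is the set of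 irreducible elements of ${\rm NC}(n)$. **The sets $\mathcal{M}(w)$.** For $w=j_1\cdots j_n\in\mathcal{M}_n$, a noncrossing partition monotonically adapted to $w$ is a set of pairs $\pi=\{(V_1,v_1),\dots,(V_k,v_k)\}$ where $\pi_0=\{V_1,\dots,V_k\}\in{\rm NC}(n)$, $v_j$ is the subword of $w$ formed by the letters of $w$ at the positions in $V_j$, and $v_j=d^{|V_j|}$ with $d=d(V_j)$ for every $j$ (i.e. the letter $j_r$ equals the depth of the block containing $r$, for each $r\in[n]$). $\mathcal{M}(w)$ is the set of all these, and $\mathcal{M}_{\rm irr}(w)$ is its subset of those with $\pi_0$ irreducible. *)

theory Defs
  imports Complex_Main "HOL-Library.Disjoint_Sets"
begin

text \<open>Positions in words and points of $[n]$ are numbered from 1, lists from 0; hence the shifts.\<close>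

definition letter :: "nat list \<Rightarrow> nat \<Rightarrow> nat" where
  "letter w k = w ! (k - 1)"

text \<open>Length 0 is excluded (the first and the last letter must exist), so
  \<open>motzkin_words 0 = {}\<close>.\<close>

definition motzkin_words :: "nat \<Rightarrow> nat list set" where
  "motzkin_words n = {w. length w = n \<and> n \<ge> 1 \<and> (\<forall>j \<in> set w. j \<ge> 1) \<and>
     letter w 1 = 1 \<and> letter w n = 1 \<and>
     (\<forall>k. 1 < k \<and> k \<le> n \<longrightarrow> \<bar>int (letter w k) - int (letter w (k - 1))\<bar> \<in> {0, 1})}"

definition noncrossing :: "nat set set \<Rightarrow> bool" where
  "noncrossing P \<longleftrightarrow>
     \<not> (\<exists>V \<in> P. \<exists>W \<in> P. V \<noteq> W \<and>
        (\<exists>a \<in> V. \<exists>b \<in> W. \<exists>c \<in> V. \<exists>d \<in> W. a < b \<and> b < c \<and> c < d))"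

definition NC :: "nat \<Rightarrow> nat set set set" where
  "NC n = {P. partition_on {1..n} P \<and> noncrossing P}"

text \<open>\<open>outer_block W V\<close>: the block \<open>W\<close> is an outer block of \<open>V\<close>.\<close>

definition outer_block :: "nat set \<Rightarrow> nat set \<Rightarrow> bool" where
  "outer_block W V \<longleftrightarrow> W \<noteq> V \<and> (\<exists>p \<in> W. \<exists>q \<in> W. \<forall>k \<in> V. p < k \<and> k < q)"

definition covering_block :: "nat set set \<Rightarrow> nat set \<Rightarrow> bool" where
  "covering_block P V \<longleftrightarrow> V \<in> P \<and> \<not> (\<exists>W \<in> P. outer_block W V)"

definition is_nearest_outer :: "nat set set \<Rightarrow> nat set \<Rightarrow> nat set \<Rightarrow> bool" where
  "is_nearest_outer P V W \<longleftrightarrow> W \<in> P \<and> outer_block W V \<and>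
     \<not> (\<exists>U \<in> P. outer_block U V \<and> outer_block W U)"

definition nearest_outer :: "nat set set \<Rightarrow> nat set \<Rightarrow> nat set" where
  "nearest_outer P V = (THE W. is_nearest_outer P V W)"

text \<open>The recursion for the depth is phrased as an inductive predicate because it terminates only
  for noncrossing partitions; that it defines a function satisfying the expected equations on
  every element of \<open>NC n\<close> is shown in \<open>depth_covering\<close> and \<open>depth_nearest_outer\<close> below.\<close>

inductive has_depth :: "nat set set \<Rightarrow> nat set \<Rightarrow> nat \<Rightarrow> bool" for P where
  covering: "covering_block P V \<Longrightarrow> has_depth P V 1"
| inner: "V \<in> P \<Longrightarrow> \<not> covering_block P V \<Longrightarrow> has_depth P (nearest_outer P V) d
    \<Longrightarrow> has_depth P V (d + 1)"

definition depth :: "nat set set \<Rightarrow> nat set \<Rightarrow> nat" where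
  "depth P V = (THE d. has_depth P V d)"

definition NC_irr :: "nat \<Rightarrow> nat set set set" where
  "NC_irr n = {P \<in> NC n. \<exists>!V. covering_block P V}"

definition subword :: "nat list \<Rightarrow> nat set \<Rightarrow> nat list" where
  "subword w V = nths w {i. Suc i \<in> V}"

definition forget_words :: "(nat set \<times> nat list) set \<Rightarrow> nat set set" where
  "forget_words Q = fst ` Q"

text \<open>No two pairs in \<open>Q\<close> can share a block, since the word attached to a block is
  determined by it.\<close>

definition adapted :: "nat list \<Rightarrow> (nat set \<times> nat list) set set" where
  "adapted w = {Q. forget_words Q \<in> NC (length w) \<and>
     (\<forall>(V, v) \<in> Q. v = subword w V \<and> v = replicate (card V) (depth (forget_words Q) V))}"

definition adapted_irr :: "nat list \<Rightarrow> (nat set \<times> nat list) set set" where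
  "adapted_irr w = {Q \<in> adapted w. forget_words Q \<in> NC_irr (length w)}"

definition catalan :: "nat \<Rightarrow> real" where
  "catalan n = 1 / (real n + 1) * real ((2 * n) choose n)"


lemma NC_block:
  assumes "P \<in> NC n" "V \<in> P"
  shows "finite V" "V \<noteq> {}"
proof -
  have "V \<subseteq> {1..n}" "{} \<notin> P" using assms unfolding NC_def partition_on_def by auto
  then show "finite V" "V \<noteq> {}" using assms(2) by (auto dest: finite_subset)
qed

lemma outer_block_Min:
  assumes "finite W" "finite V" "V \<noteq> {}" "outer_block W V"
  shows "Min W < Min V"
proof -
  obtain p where p: "p \<in> W" "\<forall>k \<in> V. p < k"
    using assms(4) unfolding outer_block_def by blast
  have "Min W \<le> p" using assms(1) p(1) by simp
  also have "p < Min V" using p(2) assms(2,3) by simp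
  finally show ?thesis .
qed

lemma outer_blocks_nested_aux:
  assumes nc: "noncrossing P" and disj: "disjoint P"
    and A: "A \<in> P" and B: "B \<in> P" and ne: "A \<noteq> B"
    and p: "p \<in> A" "q \<in> A" "p < v" "v < q"
    and p': "p' \<in> B" "q' \<in> B" "p' < v" "v < q'"
    and less: "p < p'"
  shows "outer_block A B"
proof -
  have no_cross: "\<not> (a < b \<and> b < c \<and> c < d)" if "a \<in> V" "b \<in> W" "c \<in> V" "d \<in> W"
    "V \<in> P" "W \<in> P" "V \<noteq> W" for a b c d V W
  proof
    assume "a < b \<and> b < c \<and> c < d"
    with that have "\<exists>V \<in> P. \<exists>W \<in> P. V \<noteq> W \<and>
        (\<exists>a \<in> V. \<exists>b \<in> W. \<exists>c \<in> V. \<exists>d \<in> W. a < b \<and> b < c \<and> c < d)"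
      by (intro bexI[of _ V] bexI[of _ W] conjI bexI[of _ a] bexI[of _ b] bexI[of _ c]
          bexI[of _ d]) simp_all
    with nc show False unfolding noncrossing_def by (rule notE)
  qed
  have "A \<inter> B = {}" using disj A B ne by (auto dest: disjointD)
  have "p < b \<and> b < q" if b: "b \<in> B" for b
  proof
    have "b \<noteq> p" "b \<noteq> q" using b p \<open>A \<inter> B = {}\<close> by auto
    moreover have "\<not> b < p"
      using no_cross[of b B p A p' q] b p p' less A B ne by auto
    moreover have "\<not> q < b"
      using no_cross[of p A p' B q b] b p p' less A B ne by auto
    ultimately show "p < b" "b < q" by auto
  qed
  then show ?thesis using p ne unfolding outer_block_def by blast
qed

lemma outer_blocks_nested:
  assumes P: "P \<in> NC n" and "A \<in> P" "B \<in> P" "V \<in> P" "A \<noteq> B"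
    and "outer_block A V" "outer_block B V"
  shows "outer_block A B \<or> outer_block B A"
proof -
  have nc: "noncrossing P" and disj: "disjoint P"
    using P unfolding NC_def partition_on_def by auto
  obtain v where v: "v \<in> V" using NC_block(2)[OF P \<open>V \<in> P\<close>] by blast
  obtain p q where p: "p \<in> A" "q \<in> A" "p < v" "v < q"
    using assms v unfolding outer_block_def by blast
  obtain p' q' where p': "p' \<in> B" "q' \<in> B" "p' < v" "v < q'"
    using assms v unfolding outer_block_def by blast
  have "A \<inter> B = {}" using disj assms by (auto dest: disjointD)
  then have "p \<noteq> p'" using p p' by auto
  then show ?thesis
    using outer_blocks_nested_aux[OF nc disj \<open>A \<in> P\<close> \<open>B \<in> P\<close> \<open>A \<noteq> B\<close> p p']
      outer_blocks_nested_aux[OF nc disj \<open>B \<in> P\<close> \<open>A \<in> P\<close> \<open>A \<noteq> B\<close>[symmetric] p' p]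
    by linarith
qed

lemma nearest_outer_ex1:
  assumes P: "P \<in> NC n" and V: "V \<in> P" "\<not> covering_block P V"
  shows "\<exists>!W. is_nearest_outer P V W"
proof (rule ex_ex1I)
  let ?S = "{W \<in> P. outer_block W V}"
  have "finite P" using P unfolding NC_def by (auto intro: finite_elements)
  then have "finite (Min ` ?S)" by simp
  moreover have "Min ` ?S \<noteq> {}" using V unfolding covering_block_def by auto
  ultimately have "Max (Min ` ?S) \<in> Min ` ?S" by (rule Max_in)
  then obtain W where W: "W \<in> ?S" "Max (Min ` ?S) = Min W" by auto
  have "\<not> (outer_block U V \<and> outer_block W U)" if "U \<in> P" for U
  proof
    assume *: "outer_block U V \<and> outer_block W U"
    have "Min U \<le> Max (Min ` ?S)"
      using * that \<open>finite (Min ` ?S)\<close> by (intro Max_ge) auto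
    moreover have "Min W < Min U"
      using * that W(1) NC_block[OF P] by (intro outer_block_Min) auto
    ultimately show False using W(2) by simp
  qed
  then show "\<exists>W. is_nearest_outer P V W"
    using W(1) unfolding is_nearest_outer_def by blast
next
  fix W W' assume "is_nearest_outer P V W" "is_nearest_outer P V W'"
  then show "W = W'"
    using outer_blocks_nested[OF P _ _ V(1), of W W'] unfolding is_nearest_outer_def by blast
qed

lemma nearest_outer:
  assumes "P \<in> NC n" "V \<in> P" "\<not> covering_block P V"
  shows "is_nearest_outer P V (nearest_outer P V)"
  unfolding nearest_outer_def by (rule theI'[OF nearest_outer_ex1[OF assms]])

lemma has_depth_unique:
  "has_depth P V d \<Longrightarrow> has_depth P V e \<Longrightarrow> d = e"
proof (induction arbitrary: e rule: has_depth.induct)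
  case (covering V)
  from covering.prems covering.hyps show ?case
    by (cases rule: has_depth.cases) simp_all
next
  case (inner V d)
  from inner.prems inner.hyps(2) obtain e' where "e = e' + 1" "has_depth P (nearest_outer P V) e'"
    by (cases rule: has_depth.cases) auto
  with inner.IH show ?case by simp
qed

lemma has_depth_ex:
  assumes P: "P \<in> NC n"
  shows "V \<in> P \<Longrightarrow> \<exists>d. has_depth P V d"
proof (induction "Min V" arbitrary: V rule: less_induct)
  case less
  show ?case
  proof (cases "covering_block P V")
    case True
    then show ?thesis using has_depth.covering by blast
  next
    case False
    let ?W = "nearest_outer P V"
    have W: "?W \<in> P" "outer_block ?W V"
      using nearest_outer[OF P less.prems False] unfolding is_nearest_outer_def by auto
    then have "Min ?W < Min V"
      using NC_block[OF P] less.prems by (intro outer_block_Min) auto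
    then show ?thesis using less.hyps W(1) has_depth.inner[OF less.prems False] by blast
  qed
qed

lemma depth_eqI: "has_depth P V d \<Longrightarrow> depth P V = d"
  unfolding depth_def by (rule the_equality) (auto dest: has_depth_unique)

lemma depth_covering: "covering_block P V \<Longrightarrow> depth P V = 1"
  by (intro depth_eqI has_depth.covering)

lemma depth_nearest_outer:
  assumes "P \<in> NC n" "V \<in> P" "\<not> covering_block P V"
  shows "depth P V = depth P (nearest_outer P V) + 1"
proof -
  have "nearest_outer P V \<in> P"
    using nearest_outer[OF assms] unfolding is_nearest_outer_def by simp
  then obtain d where d: "has_depth P (nearest_outer P V) d"
    using has_depth_ex[OF assms(1)] by blast
  show ?thesis
    using depth_eqI[OF has_depth.inner[OF assms(2,3) d]] depth_eqI[OF d] by simp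
qed

lemma finite_motzkin_words: "finite (motzkin_words n)"
proof -
  have le: "letter w k \<le> k" if w: "w \<in> motzkin_words n" and k: "1 \<le> k" "k \<le> n" for w k
    using k
  proof (induction k rule: dec_induct)
    case base
    then show ?case using w unfolding motzkin_words_def by simp
  next
    case (step k)
    have "\<bar>int (letter w (Suc k)) - int (letter w (Suc k - 1))\<bar> \<in> {0, 1}"
    proof -
      have "\<forall>k. 1 < k \<and> k \<le> n \<longrightarrow> \<bar>int (letter w k) - int (letter w (k - 1))\<bar> \<in> {0, 1}"
        using w unfolding motzkin_words_def by simp
      moreover have "1 < Suc k" "Suc k \<le> n" using step by auto
      ultimately show ?thesis by blast
    qed
    with step show ?case by auto
  qed
  have "motzkin_words n \<subseteq> {w. set w \<subseteq> {..n} \<and> length w = n}"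
  proof
    fix w assume w: "w \<in> motzkin_words n"
    then have len: "length w = n" unfolding motzkin_words_def by simp
    have "w ! i \<le> n" if "i < n" for i
      using le[OF w, of "Suc i"] that unfolding letter_def by simp
    then show "w \<in> {w. set w \<subseteq> {..n} \<and> length w = n}"
      using len by (auto simp: in_set_conv_nth)
  qed
  then show ?thesis
    by (rule finite_subset) (intro finite_lists_length_eq finite_atMost)
qed

lemma finite_adapted: "finite (adapted w)"
proof -
  have "adapted w \<subseteq> (\<lambda>P. (\<lambda>V. (V, subword w V)) ` P) ` Pow (Pow {1..length w})"
  proof
    fix Q assume Q: "Q \<in> adapted w"
    then have "forget_words Q \<in> NC (length w)" unfolding adapted_def by simp
    then have "forget_words Q \<in> Pow (Pow {1..length w})"
      unfolding NC_def partition_on_def by auto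
    moreover have "Q = (\<lambda>V. (V, subword w V)) ` forget_words Q"
    proof -
      have "(V, subword w V) = (V, v)" if "(V, v) \<in> Q" for V v
        using Q that unfolding adapted_def by auto
      then have "(\<lambda>p. (fst p, subword w (fst p))) p = id p" if "p \<in> Q" for p
        using that by (cases p) simp
      then have "(\<lambda>p. (fst p, subword w (fst p))) ` Q = id ` Q" by (rule image_cong[OF refl])
      then show ?thesis unfolding forget_words_def image_image by simp
    qed
    ultimately show "Q \<in> (\<lambda>P. (\<lambda>V. (V, subword w V)) ` P) ` Pow (Pow {1..length w})"
      by blast
  qed
  then show ?thesis by (rule finite_subset) simp
qed

end

theory Submission
  imports Defs
begin

text \<open>The depth of a block \<open>V\<close> exceeds the number of its outer blocks by one, hence for every
  \<open>r \<in> V\<close> it is the number of blocks \<open>W\<close> with \<open>Min W \<le> r \<le> Max W\<close>. Passing from \<open>r\<close> to \<open>r + 1\<close>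
  this count gains at most one block (the one starting at \<open>r + 1\<close>) and loses at most one (the one
  ending at \<open>r\<close>), so the depths form a Motzkin word, and it is the only word to which the partition
  is adapted. For the count, irreducible partitions of \<open>[n + 1]\<close> are those having \<open>1\<close> and \<open>n + 1\<close>
  in the same block, and deleting \<open>n + 1\<close> identifies them with \<open>NC n\<close>. Cutting a partition of
  \<open>[n + 1]\<close> after the last point of the block of \<open>1\<close> then gives the Catalan recurrence.\<close>

subsection \<open>Depths and Motzkin words\<close>

lemma noncrossingD:
  assumes "noncrossing P" "V \<in> P" "W \<in> P" "a \<in> V" "b \<in> W" "c \<in> V" "d \<in> W"
    "a < b" "b < c" "c < d"
  shows "V = W"
proof (rule ccontr)
  assume "V \<noteq> W"
  with assms have "\<exists>V \<in> P. \<exists>W \<in> P. V \<noteq> W \<and>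
      (\<exists>a \<in> V. \<exists>b \<in> W. \<exists>c \<in> V. \<exists>d \<in> W. a < b \<and> b < c \<and> c < d)"
    by (intro bexI[of _ V] bexI[of _ W] conjI bexI[of _ a] bexI[of _ b] bexI[of _ c]
        bexI[of _ d]) simp_all
  with assms(1) show False unfolding noncrossing_def by (rule notE)
qed

lemma noncrossingI:
  assumes "\<And>V W a b c d. V \<in> P \<Longrightarrow> W \<in> P \<Longrightarrow> a \<in> V \<Longrightarrow> b \<in> W \<Longrightarrow> c \<in> V \<Longrightarrow> d \<in> W \<Longrightarrow>
    a < b \<Longrightarrow> b < c \<Longrightarrow> c < d \<Longrightarrow> V = W"
  shows "noncrossing P"
  unfolding noncrossing_def
proof (rule notI, elim bexE conjE)
  fix V W a b c d
  assume "V \<in> P" "W \<in> P" "V \<noteq> W" "a \<in> V" "b \<in> W" "c \<in> V" "d \<in> W" "a < b" "b < c" "c < d"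
  then show False using assms[of V W a b c d] by simp
qed

lemma noncrossing_subset:
  assumes "noncrossing P" "Q \<subseteq> P"
  shows "noncrossing Q"
proof (rule noncrossingI)
  fix V W a b c d
  assume "V \<in> Q" "W \<in> Q" "a \<in> V" "b \<in> W" "c \<in> V" "d \<in> W" "a < b" "b < c" "c < d"
  moreover from this assms(2) have "V \<in> P" "W \<in> P" by blast+
  ultimately show "V = W" using noncrossingD[OF assms(1)] by metis
qed

lemma partition_onI_eq:
  assumes "\<Union>P = A" "{} \<notin> P" "\<And>V W x. V \<in> P \<Longrightarrow> W \<in> P \<Longrightarrow> x \<in> V \<Longrightarrow> x \<in> W \<Longrightarrow> V = W"
  shows "partition_on A P"
  using assms by (intro partition_onI) (auto simp: disjnt_iff)

lemma partition_on_block_eq: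
  assumes "partition_on A P" "V \<in> P" "W \<in> P" "x \<in> V" "x \<in> W"
  shows "V = W"
  using assms unfolding partition_on_def by (blast dest: disjointD)

lemma NC_D:
  assumes "P \<in> NC n"
  shows "partition_on {1..n} P" "noncrossing P" "finite P"
  using assms unfolding NC_def by (auto intro: finite_elements)

lemma NC_block_subset: "P \<in> NC n \<Longrightarrow> V \<in> P \<Longrightarrow> V \<subseteq> {1..n}"
  unfolding NC_def partition_on_def by auto

section \<open>Depth as a count of outer blocks and of blocks spanning a point\<close>

lemma outer_block_trans:
  assumes "outer_block U W" "outer_block W V"
  shows "outer_block U V"
proof -
  obtain p q where p: "p \<in> U" "q \<in> U" "\<forall>k \<in> W. p < k \<and> k < q"
    using assms(1) unfolding outer_block_def by blast
  obtain p' q' where p': "p' \<in> W" "q' \<in> W" "\<forall>k \<in> V. p' < k \<and> k < q'"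
    using assms(2) unfolding outer_block_def by blast
  have *: "\<forall>k \<in> V. p < k \<and> k < q"
    using p(3)[rule_format, OF p'(1)] p(3)[rule_format, OF p'(2)] p'(3) by force
  moreover have "U \<noteq> V" using p(1) * by blast
  ultimately show ?thesis using p unfolding outer_block_def by blast
qed

text \<open>The outer blocks of \<open>V\<close> form a chain whose innermost member is the nearest
  one, so they are this block together with its own outer blocks. Induction on \<open>Min V\<close>
  works because the nearest outer block starts strictly earlier.\<close>

lemma depth_eq_card_outer:
  assumes P: "P \<in> NC n"
  shows "V \<in> P \<Longrightarrow> depth P V = Suc (card {W \<in> P. outer_block W V})"
proof (induction "Min V" arbitrary: V rule: less_induct)
  case less
  show ?case
  proof (cases "covering_block P V")
    case True
    then have "{W \<in> P. outer_block W V} = {}" unfolding covering_block_def by auto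
    then show ?thesis unfolding depth_covering[OF True] by (simp only: card.empty One_nat_def)
  next
    case False
    define N where "N = nearest_outer P V"
    have N: "N \<in> P" "outer_block N V" "\<And>U. U \<in> P \<Longrightarrow> outer_block U V \<Longrightarrow> \<not> outer_block N U"
      using nearest_outer[OF P less.prems False] unfolding is_nearest_outer_def N_def by auto
    have "Min N < Min V"
      using NC_block[OF P] less.prems N by (intro outer_block_Min) auto
    then have IH: "depth P N = Suc (card {W \<in> P. outer_block W N})"
      using less.hyps N(1) by blast
    have "{W \<in> P. outer_block W V} = insert N {W \<in> P. outer_block W N}"
    proof
      \<comment> \<open>By nesting, an outer block of \<open>V\<close> other than \<open>N\<close>
        encloses \<open>N\<close> or is enclosed by it; the second would contradict that
        \<open>N\<close> is nearest.\<close>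
      show "{W \<in> P. outer_block W V} \<subseteq> insert N {W \<in> P. outer_block W N}"
        using outer_blocks_nested[OF P _ N(1) less.prems] N by blast
      show "insert N {W \<in> P. outer_block W N} \<subseteq> {W \<in> P. outer_block W V}"
        using N outer_block_trans by blast
    qed
    moreover have "\<not> outer_block N N" unfolding outer_block_def by simp
    ultimately have "card {W \<in> P. outer_block W V} = Suc (card {W \<in> P. outer_block W N})"
      using NC_D(3)[OF P] by simp
    then show ?thesis
      using depth_nearest_outer[OF P less.prems False] IH by (simp add: N_def)
  qed
qed

text \<open>Refers to a point rather than to a block, so that the depths at \<open>r\<close> and
  \<open>r + 1\<close> can be compared even if these points lie in unrelated blocks.\<close>

definition spanning :: "nat set set \<Rightarrow> nat \<Rightarrow> nat set set" where
  "spanning P r = {W \<in> P. Min W \<le> r \<and> r \<le> Max W}"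

text \<open>The endpoints of \<open>W\<close> are not in \<open>V\<close>. If \<open>V\<close> has
  one point between them and another one beyond them, then \<open>V\<close> and \<open>W\<close>
  cross, so one point of \<open>V\<close> decides for all.\<close>

lemma outer_block_iff_span:
  assumes P: "P \<in> NC n" and V: "V \<in> P" "r \<in> V" and W: "W \<in> P" "W \<noteq> V"
  shows "outer_block W V \<longleftrightarrow> Min W \<le> r \<and> r \<le> Max W"
proof
  note fin = NC_block[OF P W(1)]
  assume "outer_block W V"
  then obtain p q where "p \<in> W" "q \<in> W" "p < r" "r < q"
    using V unfolding outer_block_def by blast
  then show "Min W \<le> r \<and> r \<le> Max W"
    using Min_le[OF fin(1), of p] Max_ge[OF fin(1), of q] by linarith
next
  note fin = NC_block[OF P W(1)]
  assume r: "Min W \<le> r \<and> r \<le> Max W"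
  have mem: "Min W \<in> W" "Max W \<in> W" using fin by simp_all
  have ne: "k \<noteq> Min W" "k \<noteq> Max W" if "k \<in> V" for k
    using partition_on_block_eq[OF NC_D(1)[OF P] V(1) W(1) that] mem W(2) by auto
  have "Min W < k \<and> k < Max W" if k: "k \<in> V" for k
  proof (rule ccontr)
    assume "\<not> ?thesis"
    then have "k < Min W \<or> Max W < k" using ne[OF k] by linarith
    moreover have "Min W < r" "r < Max W" using r ne[OF V(2)] by auto
    \<comment> \<open>The crossing is \<open>k < Min W < r < Max W\<close> or
      \<open>Min W < r < Max W < k\<close>.\<close>
    ultimately show False
      using noncrossingD[OF NC_D(2)[OF P] V(1) W(1) k mem(1) V(2) mem(2)]
        noncrossingD[OF NC_D(2)[OF P] W(1) V(1) mem(1) V(2) mem(2) k] W(2) by auto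
  qed
  then show "outer_block W V" using mem W(2) unfolding outer_block_def by blast
qed

text \<open>The successor in \<open>depth_eq_card_outer\<close> is accounted for by
  \<open>V\<close>, which spans its own point \<open>r\<close> but is not its own outer
  block.\<close>

lemma depth_eq_card_spanning:
  assumes P: "P \<in> NC n" and V: "V \<in> P" "r \<in> V"
  shows "depth P V = card (spanning P r)"
proof -
  have "Min V \<le> r" "r \<le> Max V" using NC_block[OF P V(1)] V(2) by simp_all
  then have "spanning P r = insert V {W \<in> P. outer_block W V}"
    using outer_block_iff_span[OF P V] V(1) unfolding spanning_def
    by (auto simp: outer_block_def)
  moreover have "\<not> outer_block V V" unfolding outer_block_def by simp
  ultimately show ?thesis using NC_D(3)[OF P] depth_eq_card_outer[OF P V(1)] by simp
qed

lemma card_le_Suc_card: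
  assumes "A - B \<subseteq> C" "finite B" "finite C" "card C \<le> 1"
  shows "card A \<le> Suc (card B)"
proof -
  have "card A \<le> card (B \<union> C)" using assms by (intro card_mono) auto
  also have "\<dots> \<le> card B + card C" by (rule card_Un_le)
  finally show ?thesis using assms(4) by simp
qed

lemma card_blocks_with_le_1:
  assumes P: "P \<in> NC n"
  shows "card {W \<in> P. r \<in> W} \<le> 1"
proof -
  have "finite {W \<in> P. r \<in> W}" using NC_D(3)[OF P] by simp
  moreover have "V = W" if "V \<in> {W \<in> P. r \<in> W}" "W \<in> {W \<in> P. r \<in> W}" for V W
    using that partition_on_block_eq[OF NC_D(1)[OF P], of V W r] by simp
  ultimately show ?thesis by (simp add: card_le_Suc0_iff_eq)
qed

lemma card_spanning_steps:
  assumes P: "P \<in> NC n"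
  shows "card (spanning P (Suc r)) \<le> Suc (card (spanning P r))"
    "card (spanning P r) \<le> Suc (card (spanning P (Suc r)))"
proof -
  have fin: "finite (spanning P k)" "finite {W \<in> P. k \<in> W}" for k
    unfolding spanning_def using NC_D(3)[OF P] by simp_all
  have mem: "Min W \<in> W" "Max W \<in> W" if "W \<in> P" for W
    using NC_block[OF P that] by simp_all
  have "spanning P (Suc r) - spanning P r \<subseteq> {W \<in> P. Suc r \<in> W}"
  proof
    fix W assume "W \<in> spanning P (Suc r) - spanning P r"
    then have W: "W \<in> P" "Min W = Suc r" unfolding spanning_def by auto
    then show "W \<in> {W \<in> P. Suc r \<in> W}" using mem(1)[OF W(1)] by simp
  qed
  then show "card (spanning P (Suc r)) \<le> Suc (card (spanning P r))"
    by (rule card_le_Suc_card) (rule fin card_blocks_with_le_1[OF P])+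
  have "spanning P r - spanning P (Suc r) \<subseteq> {W \<in> P. r \<in> W}"
  proof
    fix W assume "W \<in> spanning P r - spanning P (Suc r)"
    then have W: "W \<in> P" "Max W = r" unfolding spanning_def by auto
    then show "W \<in> {W \<in> P. r \<in> W}" using mem(2)[OF W(1)] by simp
  qed
  then show "card (spanning P r) \<le> Suc (card (spanning P (Suc r)))"
    by (rule card_le_Suc_card) (rule fin card_blocks_with_le_1[OF P])+
qed

text \<open>No block starts before 1 or ends after \<open>n\<close>, so a block spanning one of
  these points has it as its minimum or maximum.\<close>

lemma spanning_boundary:
  assumes P: "P \<in> NC n" and r: "r = 1 \<or> r = n"
  shows "spanning P r \<subseteq> {W \<in> P. r \<in> W}"
proof
  fix W assume W: "W \<in> spanning P r"
  then have "W \<in> P" unfolding spanning_def by simp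
  then have "Min W \<in> W" "Max W \<in> W" "W \<subseteq> {1..n}"
    using NC_block[OF P] NC_block_subset[OF P] by simp_all
  moreover from this have "Min W \<ge> 1" "Max W \<le> n" by auto
  ultimately show "W \<in> {W \<in> P. r \<in> W}"
    using r W unfolding spanning_def by (auto dest!: le_antisym)
qed

lemma card_spanning_pos:
  assumes P: "P \<in> NC n" and r: "r \<in> {1..n}"
  shows "1 \<le> card (spanning P r)"
proof -
  have "\<Union>P = {1..n}" using NC_D(1)[OF P] unfolding partition_on_def by simp
  then obtain V where V: "V \<in> P" "r \<in> V" using r by blast
  then have "V \<in> spanning P r" using NC_block[OF P V(1)] unfolding spanning_def by simp
  moreover have "finite (spanning P r)" unfolding spanning_def using NC_D(3)[OF P] by simp
  ultimately show ?thesis by (metis One_nat_def Suc_leI card_gt_0_iff empty_iff)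
qed

lemma card_spanning_boundary:
  assumes P: "P \<in> NC n" and n: "1 \<le> n" and r: "r = 1 \<or> r = n"
  shows "card (spanning P r) = 1"
proof (rule antisym)
  have "card (spanning P r) \<le> card {W \<in> P. r \<in> W}"
    using NC_D(3)[OF P] by (intro card_mono spanning_boundary[OF P r]) simp
  also have "\<dots> \<le> 1" by (rule card_blocks_with_le_1[OF P])
  finally show "card (spanning P r) \<le> 1" .
  show "1 \<le> card (spanning P r)" using n r by (intro card_spanning_pos[OF P]) auto
qed

section \<open>The Motzkin word of depths\<close>

definition depth_word :: "nat \<Rightarrow> nat set set \<Rightarrow> nat list" where
  "depth_word n P = map (card \<circ> spanning P) [1..<Suc n]"

lemma length_depth_word [simp]: "length (depth_word n P) = n"
  unfolding depth_word_def by simp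

lemma letter_depth_word:
  assumes "r \<in> {1..n}"
  shows "letter (depth_word n P) r = card (spanning P r)"
proof -
  have "r - 1 < length [1..<Suc n]" "[1..<Suc n] ! (r - 1) = r"
    using assms by (auto simp del: upt_Suc)
  then show ?thesis unfolding letter_def depth_word_def by (simp del: upt_Suc)
qed

lemma word_eqI:
  assumes "length w = length w'" "\<And>r. r \<in> {1..length w} \<Longrightarrow> letter w r = letter w' r"
  shows "w = w'"
proof (rule nth_equalityI)
  fix i assume "i < length w"
  then show "w ! i = w' ! i" using assms(2)[of "Suc i"] unfolding letter_def by simp
qed (rule assms(1))

lemma depth_word_motzkin:
  assumes P: "P \<in> NC n" and n: "1 \<le> n"
  shows "depth_word n P \<in> motzkin_words n"
proof -
  have "1 \<le> j" if "j \<in> set (depth_word n P)" for j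
    using that card_spanning_pos[OF P] unfolding depth_word_def by (auto simp del: upt_Suc)
  moreover have "\<bar>int (letter (depth_word n P) k) - int (letter (depth_word n P) (k - 1))\<bar> \<in> {0, 1}"
    if k: "1 < k" "k \<le> n" for k
  proof -
    obtain m where m: "k = Suc m" "1 \<le> m" using k by (cases k) auto
    have "letter (depth_word n P) (Suc m) = card (spanning P (Suc m))"
      "letter (depth_word n P) m = card (spanning P m)"
      using k m by (auto intro!: letter_depth_word)
    then show ?thesis using card_spanning_steps[OF P, of m] m by auto
  qed
  ultimately show ?thesis
    using n letter_depth_word[of 1 n P] letter_depth_word[of n n P]
      card_spanning_boundary[OF P n, of 1] card_spanning_boundary[OF P n, of n]
    unfolding motzkin_words_def by auto
qed

text \<open>The subword has \<open>card V\<close> entries because all points of \<open>V\<close> are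
  positions of \<open>w\<close>. It is therefore this power of \<open>d\<close> as soon as all its
  entries equal \<open>d\<close>.\<close>

lemma subword_eq_replicate_iff:
  assumes "V \<subseteq> {1..length w}"
  shows "subword w V = replicate (card V) d \<longleftrightarrow> (\<forall>r\<in>V. letter w r = d)"
proof -
  \<comment> \<open>\<open>Suc\<close> translates the list indices selected by \<open>nths\<close>
    into the points of \<open>V\<close>; both the length and the set of entries of the subword
    follow from this.\<close>
  have im: "Suc ` {i. i < length w \<and> Suc i \<in> V} = V"
  proof
    show "V \<subseteq> Suc ` {i. i < length w \<and> Suc i \<in> V}"
    proof
      fix r assume "r \<in> V"
      moreover from this assms have "1 \<le> r" "r \<le> length w" by auto
      ultimately have "r = Suc (r - 1)" "r - 1 \<in> {i. i < length w \<and> Suc i \<in> V}" by auto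
      then show "r \<in> Suc ` {i. i < length w \<and> Suc i \<in> V}" by blast
    qed
  qed auto
  have "card V = card {i. i < length w \<and> Suc i \<in> V}"
    using card_image[of Suc "{i. i < length w \<and> Suc i \<in> V}"] by (simp add: im)
  then have len: "length (subword w V) = card V" unfolding subword_def by (simp add: length_nths)
  have set: "set (subword w V) = letter w ` V"
  proof -
    have "set (subword w V) = {w ! i |i. i < length w \<and> Suc i \<in> V}"
      unfolding subword_def by (simp add: set_nths)
    also have "\<dots> = letter w ` Suc ` {i. i < length w \<and> Suc i \<in> V}"
      unfolding letter_def image_image by auto
    finally show ?thesis unfolding im .
  qed
  have "subword w V = replicate (card V) d \<longleftrightarrow> (\<forall>x\<in>set (subword w V). x = d)"
  proof
    assume "subword w V = replicate (card V) d"
    then show "\<forall>x\<in>set (subword w V). x = d" by simp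
  next
    assume "\<forall>x\<in>set (subword w V). x = d"
    then show "subword w V = replicate (card V) d" using len by (intro replicate_eqI) auto
  qed
  then show ?thesis unfolding set by simp
qed

section \<open>Partitions with attached words and the bijection\<close>

definition attach_words :: "nat list \<Rightarrow> nat set set \<Rightarrow> (nat set \<times> nat list) set" where
  "attach_words w P = (\<lambda>V. (V, subword w V)) ` P"

lemma forget_attach_words [simp]: "forget_words (attach_words w P) = P"
  unfolding forget_words_def attach_words_def image_image by simp

text \<open>Turns the clause of \<open>adapted\<close> on the attached subwords into the statement
  that \<open>Q\<close> is recovered from \<open>w\<close> and its underlying partition.\<close>

lemma attach_forget_words_iff:
  "attach_words w (forget_words Q) = Q \<longleftrightarrow> (\<forall>(V, v)\<in>Q. v = subword w V)"
proof -
  have eq: "attach_words w (forget_words Q) = (\<lambda>p. (fst p, subword w (fst p))) ` Q"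
    unfolding forget_words_def attach_words_def image_image ..
  show ?thesis
  proof
    assume *: "attach_words w (forget_words Q) = Q"
    show "\<forall>(V, v)\<in>Q. v = subword w V"
    proof clarify
      fix V v assume "(V, v) \<in> Q"
      then have "(V, v) \<in> attach_words w (forget_words Q)" unfolding * .
      then show "v = subword w V" unfolding eq by auto
    qed
  next
    assume "\<forall>(V, v)\<in>Q. v = subword w V"
    then have "(\<lambda>p. (fst p, subword w (fst p))) ` Q = id ` Q" by (intro image_cong) auto
    then show "attach_words w (forget_words Q) = Q" unfolding eq by simp
  qed
qed

text \<open>Each letter must be the depth of the block at its position, which is the number of
  blocks spanning that position. As the blocks cover all positions, this determines every letter of
  \<open>w\<close> from the partition.\<close>

lemma adapted_iff:
  "Q \<in> adapted w \<longleftrightarrow> forget_words Q \<in> NC (length w) \<and>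
     w = depth_word (length w) (forget_words Q) \<and> attach_words w (forget_words Q) = Q"
\<comment> \<open>Either side of the equivalence implies this condition, so only the case where it
  holds has content.\<close>
proof (cases "forget_words Q \<in> NC (length w) \<and> attach_words w (forget_words Q) = Q")
  case False
  then show ?thesis unfolding attach_forget_words_iff adapted_def by blast
next
  case True
  define P where "P = forget_words Q"
  have P: "P \<in> NC (length w)" and Q: "Q = attach_words w P" using True by (simp_all add: P_def)
  have U: "\<Union>P = {1..length w}" using NC_D(1)[OF P] unfolding partition_on_def by simp
  have "Q \<in> adapted w
      \<longleftrightarrow> (\<forall>(V, v)\<in>Q. v = subword w V \<and> v = replicate (card V) (depth P V))"
    using P unfolding adapted_def P_def by simp
  also have "\<dots> \<longleftrightarrow> (\<forall>V\<in>P. subword w V = replicate (card V) (depth P V))"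
    by (subst Q) (simp add: attach_words_def)
  also have "\<dots> \<longleftrightarrow> (\<forall>V\<in>P. \<forall>r\<in>V. letter w r = depth P V)"
    using subword_eq_replicate_iff[OF NC_block_subset[OF P]] by simp
  also have "\<dots> \<longleftrightarrow> (\<forall>V\<in>P. \<forall>r\<in>V. letter w r = card (spanning P r))"
    using depth_eq_card_spanning[OF P] by simp
  also have "\<dots> \<longleftrightarrow> (\<forall>r\<in>{1..length w}. letter w r = card (spanning P r))"
    unfolding U[symmetric] by blast
  also have "\<dots> \<longleftrightarrow> w = depth_word (length w) P"
  proof
    assume "\<forall>r\<in>{1..length w}. letter w r = card (spanning P r)"
    then show "w = depth_word (length w) P"
      by (intro word_eqI) (simp_all add: letter_depth_word)
  next
    assume w: "w = depth_word (length w) P"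
    show "\<forall>r\<in>{1..length w}. letter w r = card (spanning P r)"
      using letter_depth_word[of _ "length w" P] w by simp
  qed
  finally show ?thesis using True by (simp add: P_def)
qed

text \<open>The union of the blocks gives the length of the word, and then the word is the depth
  word of the partition.\<close>

lemma adapted_word_unique:
  assumes "Q \<in> adapted w" "Q \<in> adapted w'"
  shows "w = w'"
proof -
  have "{1..length w} = \<Union>(forget_words Q)" "{1..length w'} = \<Union>(forget_words Q)"
    using assms NC_D(1) unfolding adapted_iff partition_on_def by metis+
  then have "length w = length w'" by (metis card_atLeastAtMost diff_Suc_1)
  then show ?thesis using assms unfolding adapted_iff by metis
qed

text \<open>Stated for a subset \<open>S\<close> so that it covers both \<open>NC n\<close> and
  \<open>NC_irr n\<close>.\<close>

lemma bij_betw_forget_words: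
  assumes n: "1 \<le> n" and S: "S \<subseteq> NC n"
  shows "bij_betw (\<lambda>P. attach_words (depth_word n P) P) S
      (\<Union>w\<in>motzkin_words n. {Q \<in> adapted w. forget_words Q \<in> S})"
proof (rule bij_betw_byWitness[where f' = forget_words])
  show "\<forall>Q\<in>\<Union>w\<in>motzkin_words n. {Q \<in> adapted w. forget_words Q \<in> S}.
      attach_words (depth_word n (forget_words Q)) (forget_words Q) = Q"
  proof
    fix Q assume "Q \<in> (\<Union>w\<in>motzkin_words n. {Q \<in> adapted w. forget_words Q \<in> S})"
    then obtain w where w: "w \<in> motzkin_words n" "Q \<in> adapted w" by blast
    then have "length w = n" unfolding motzkin_words_def by simp
    then show "attach_words (depth_word n (forget_words Q)) (forget_words Q) = Q"
      using w(2) unfolding adapted_iff by metis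
  qed
  show "(\<lambda>P. attach_words (depth_word n P) P) ` S
      \<subseteq> (\<Union>w\<in>motzkin_words n. {Q \<in> adapted w. forget_words Q \<in> S})"
  proof
    fix Q assume "Q \<in> (\<lambda>P. attach_words (depth_word n P) P) ` S"
    then obtain P where P: "P \<in> S" "Q = attach_words (depth_word n P) P" by blast
    then have "P \<in> NC n" using S by blast
    then have "depth_word n P \<in> motzkin_words n" "Q \<in> adapted (depth_word n P)"
      using depth_word_motzkin[OF _ n] P(2) by (simp_all add: adapted_iff)
    then show "Q \<in> (\<Union>w\<in>motzkin_words n. {Q \<in> adapted w. forget_words Q \<in> S})"
      using P by auto
  qed
qed auto

text \<open>Forgetting undoes \<open>attach_words\<close> whatever word \<open>u P\<close> was
  used.\<close>

lemma inv_into_bij_betw_forget_words: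
  assumes "bij_betw (\<lambda>P. attach_words (u P) P) S T" "Q \<in> T"
  shows "inv_into S (\<lambda>P. attach_words (u P) P) Q = forget_words Q"
proof -
  obtain P where P: "P \<in> S" "Q = attach_words (u P) P"
    using assms unfolding bij_betw_def by blast
  then show ?thesis using inv_into_f_f[OF bij_betw_imp_inj_on[OF assms(1)] P(1)] by simp
qed

subsection \<open>The Catalan recurrence\<close>

lemma catalan_0: "catalan 0 = 1"
  unfolding catalan_def by simp

text \<open>The ratio of consecutive Catalan numbers, free of denominators. It combines
  \<open>b = 2 * c\<close> with \<open>(n + 1) * c = (2 * n + 1) * d\<close> for the three binomial
  coefficients named in the proof.\<close>

lemma catalan_Suc: "(real n + 2) * catalan (Suc n) = (4 * real n + 2) * catalan n"
proof -
  define b c d where "b = ((2 * Suc n) choose Suc n)" and "c = (Suc (2 * n) choose n)"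
    and "d = (2 * n choose n)"
  have "Suc n * b = (2 * Suc n) * c"
    using Suc_times_binomial_eq[of "Suc (2 * n)" n] by (simp add: b_def c_def)
  then have "Suc n * b = Suc n * (2 * c)" by simp
  then have b: "b = 2 * c" by (simp only: mult_cancel1) simp
  have "Suc n * c = Suc (2 * n) * d"
    using binomial_absorb_comp[of "Suc (2 * n)" n] by (simp add: c_def d_def)
  then have "real (Suc n * c) = real (Suc (2 * n) * d)" by simp
  then have "(real n + 1) * real b = (4 * real n + 2) * real d"
    unfolding b by (simp add: algebra_simps)
  then have "real b = (4 * real n + 2) * (real d / (real n + 1))"
    by (simp add: field_simps)
  moreover have "catalan (Suc n) = real b / (real n + 2)"
    unfolding catalan_def b_def[symmetric] by (simp add: add.commute)
  moreover have "catalan n = real d / (real n + 1)"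
    unfolding catalan_def d_def by simp
  ultimately show ?thesis by simp
qed

text \<open>Adding the weighted sum to its reflection under \<open>i\<close> to \<open>n - i\<close>
  replaces the weight by \<open>i + (n - i) = n\<close>.\<close>

lemma sum_mult_reflect:
  fixes a :: "nat \<Rightarrow> real"
  shows "2 * (\<Sum>i\<le>n. real i * a i * a (n - i)) = real n * (\<Sum>i\<le>n. a i * a (n - i))"
proof -
  have "(\<Sum>i\<le>n. real i * a i * a (n - i)) = (\<Sum>i\<le>n. real (n - i) * a (n - i) * a (n - (n - i)))"
    \<comment> \<open>The library rule reindexes \<open>{..<n}\<close> by \<open>n - Suc i\<close>;
      at \<open>Suc n\<close> this becomes the reflection of \<open>{..n}\<close>.\<close>
    by (rule sum.nat_diff_reindex[symmetric, where n = "Suc n", simplified lessThan_Suc_atMost, simplified])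
  also have "\<dots> = (\<Sum>i\<le>n. real (n - i) * a i * a (n - i))"
    by (intro sum.cong) (auto simp: mult_ac)
  finally have "2 * (\<Sum>i\<le>n. real i * a i * a (n - i))
      = (\<Sum>i\<le>n. real i * a i * a (n - i)) + (\<Sum>i\<le>n. real (n - i) * a i * a (n - i))"
    by simp
  also have "\<dots> = (\<Sum>i\<le>n. real n * (a i * a (n - i)))"
    unfolding sum.distrib[symmetric] by (intro sum.cong) (auto simp: of_nat_diff algebra_simps)
  finally show ?thesis by (simp add: sum_distrib_left)
qed

text \<open>Weighting the convolution by \<open>i + 1\<close> gives \<open>n/2 + 1\<close> times the convolution by symmetry,
  while \<open>(i + 1) C\<^sub>i = (4 i - 2) C\<^bsub>i-1\<^esub>\<close> reduces it to the previous convolution.\<close>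

lemma catalan_convolution: "(\<Sum>i\<le>n. catalan i * catalan (n - i)) = catalan (Suc n)"
proof (induction n)
  case 0
  show ?case using catalan_Suc[of 0] by (simp add: catalan_0)
next
  case (Suc n)
  let ?T = "\<lambda>n. \<Sum>i\<le>n. catalan i * catalan (n - i)"
  let ?S = "\<lambda>n. \<Sum>i\<le>n. real i * catalan i * catalan (n - i)"
  have "(real (Suc n) + 2) * ?T (Suc n) = 2 * ?S (Suc n) + 2 * ?T (Suc n)"
    unfolding sum_mult_reflect[of catalan] by (simp only: distrib_right)
  also have "\<dots> = 2 * (\<Sum>i\<le>Suc n. (real i + 1) * catalan i * catalan (Suc n - i))"
    by (simp only: distrib_left distrib_right sum.distrib mult_1 sum_distrib_left)
  \<comment> \<open>Splitting off \<open>i = 0\<close> shifts the index, so that the weight becomes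
    the factor \<open>i + 2\<close> of \<open>catalan_Suc\<close>.\<close>
  also have "\<dots> = 2 * catalan (Suc n)
      + 2 * (\<Sum>i\<le>n. (real (Suc i) + 1) * catalan (Suc i) * catalan (n - i))"
    by (simp only: sum.atMost_Suc_shift) (simp add: catalan_0)
  also have "(\<Sum>i\<le>n. (real (Suc i) + 1) * catalan (Suc i) * catalan (n - i))
      = (\<Sum>i\<le>n. (4 * real i + 2) * catalan i * catalan (n - i))"
    using catalan_Suc by (intro sum.cong) (simp_all add: add.commute)
  also have "\<dots> = 4 * ?S n + 2 * ?T n"
    by (simp add: distrib_right sum.distrib sum_distrib_left mult.assoc)
  also have "\<dots> = 2 * (2 * ?S n) + 2 * ?T n" by simp
  also have "\<dots> = (2 * real n + 2) * catalan (Suc n)"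
    unfolding sum_mult_reflect[of catalan] Suc.IH by (simp add: algebra_simps)
  \<comment> \<open>The coefficients of \<open>catalan (Suc n)\<close> add up to
    \<open>2 + 2 * (2 * n + 2) = 4 * (n + 1) + 2\<close>, the factor in \<open>catalan_Suc\<close>
    at \<open>Suc n\<close>.\<close>
  finally have "(real (Suc n) + 2) * ?T (Suc n) = (real (Suc n) + 2) * catalan (Suc (Suc n))"
    unfolding catalan_Suc by (simp add: algebra_simps)
  moreover have "real (Suc n) + 2 \<noteq> 0" by linarith
  ultimately show ?case by (metis mult_left_cancel)
qed

subsection \<open>Counting noncrossing partitions\<close>

text \<open>Nothing lies beyond 1 and \<open>n\<close>, so their blocks are always covering. If the
  two blocks coincide, every other block lies strictly between 1 and \<open>n\<close> and hence
  inside that block.\<close>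

lemma NC_irr_iff:
  assumes n: "1 \<le> n"
  shows "P \<in> NC_irr n \<longleftrightarrow> P \<in> NC n \<and> (\<exists>V\<in>P. 1 \<in> V \<and> n \<in> V)"
proof (cases "P \<in> NC n")
  case P: True
  have U: "\<Union>P = {1..n}" using NC_D(1)[OF P] unfolding partition_on_def by simp
  have cover: "covering_block P V" if V: "V \<in> P" "1 \<in> V \<or> n \<in> V" for V
  proof -
    have "\<not> outer_block W V" if "W \<in> P" for W
    proof
      assume "outer_block W V"
      then obtain p q where "p \<in> W" "q \<in> W" "\<forall>k\<in>V. p < k \<and> k < q"
        unfolding outer_block_def by blast
      moreover from this have "p \<in> {1..n}" "q \<in> {1..n}"
        using NC_block_subset[OF P that] by blast+
      ultimately show False using V(2) by force
    qed
    then show ?thesis using V(1) unfolding covering_block_def by blast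
  qed
  have "(\<exists>!V. covering_block P V) \<longleftrightarrow> (\<exists>V\<in>P. 1 \<in> V \<and> n \<in> V)"
  proof
    obtain V W where "V \<in> P" "1 \<in> V" "W \<in> P" "n \<in> W"
      using U n by (metis Union_iff atLeastAtMost_iff order_refl)
    moreover assume "\<exists>!V. covering_block P V"
    ultimately show "\<exists>V\<in>P. 1 \<in> V \<and> n \<in> V" using cover by metis
  next
    assume "\<exists>V\<in>P. 1 \<in> V \<and> n \<in> V"
    then obtain V where V: "V \<in> P" "1 \<in> V" "n \<in> V" by blast
    have "W = V" if W: "covering_block P W" for W
    proof (rule ccontr)
      assume ne: "W \<noteq> V"
      have WP: "W \<in> P" using W unfolding covering_block_def by simp
      have "1 < k \<and> k < n" if k: "k \<in> W" for k
      proof -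
        have "k \<noteq> 1" "k \<noteq> n"
          using partition_on_block_eq[OF NC_D(1)[OF P] WP V(1) k] ne V by auto
        moreover have "k \<in> {1..n}" using NC_block_subset[OF P WP] k by blast
        ultimately show ?thesis by auto
      qed
      then have "outer_block V W" using V ne unfolding outer_block_def by blast
      then show False using W V(1) unfolding covering_block_def by blast
    qed
    then show "\<exists>!V. covering_block P V" using cover V by blast
  qed
  then show ?thesis using P unfolding NC_irr_def by simp
qed (simp add: NC_irr_def)

section \<open>Irreducible partitions of [n + 1] against partitions of [n]\<close>

definition delete_point :: "nat \<Rightarrow> nat set set \<Rightarrow> nat set set" where
  "delete_point m P = (\<lambda>V. V - {m}) ` P"

text \<open>In an irreducible partition the last point shares the block of 1, so after its deletion
  the place to reinsert it is known.\<close>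

definition close_up :: "nat \<Rightarrow> nat set set \<Rightarrow> nat set set" where
  "close_up m P = (\<lambda>V. if 1 \<in> V then insert m V else V) ` P"

text \<open>Deletion cannot empty a block: the block of \<open>Suc n\<close> also contains 1, and 1
  differs from \<open>Suc n\<close> because \<open>n\<close> is positive.\<close>

lemma delete_point_NC:
  assumes n: "1 \<le> n" and P: "P \<in> NC_irr (Suc n)"
  shows "delete_point (Suc n) P \<in> NC n"
proof -
  obtain B where PN: "P \<in> NC (Suc n)" and B: "B \<in> P" "1 \<in> B" "Suc n \<in> B"
    using P NC_irr_iff[of "Suc n" P] by auto
  note eq = partition_on_block_eq[OF NC_D(1)[OF PN]]
  have U: "\<Union>P = {1..Suc n}" using NC_D(1)[OF PN] unfolding partition_on_def by simp
  have "partition_on {1..n} (delete_point (Suc n) P)"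
  proof (rule partition_onI_eq)
    have "\<Union>(delete_point (Suc n) P) = \<Union>P - {Suc n}" unfolding delete_point_def by blast
    also have "\<dots> = {1..n}" unfolding U by auto
    finally show "\<Union>(delete_point (Suc n) P) = {1..n}" .
    have "V - {Suc n} \<noteq> {}" if "V \<in> P" for V
    proof (cases "Suc n \<in> V")
      case True
      then have "1 \<in> V" using eq[OF that B(1) True B(3)] B(2) by simp
      then show ?thesis using n by auto
    next
      case False
      then show ?thesis using NC_block[OF PN that] by simp
    qed
    then show "{} \<notin> delete_point (Suc n) P" unfolding delete_point_def by (metis imageE)
    show "V = W" if "V \<in> delete_point (Suc n) P" "W \<in> delete_point (Suc n) P" "x \<in> V" "x \<in> W"
      for V W x
      using that eq unfolding delete_point_def by blast
  qed
  moreover have "noncrossing (delete_point (Suc n) P)"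
  proof (rule noncrossingI)
    fix V' W' a b c d
    assume "V' \<in> delete_point (Suc n) P" "W' \<in> delete_point (Suc n) P"
      and *: "a \<in> V'" "b \<in> W'" "c \<in> V'" "d \<in> W'" "a < b" "b < c" "c < d"
    then obtain V W where V: "V \<in> P" "V' = V - {Suc n}" "W \<in> P" "W' = W - {Suc n}"
      unfolding delete_point_def by blast
    then have "a \<in> V" "b \<in> W" "c \<in> V" "d \<in> W" using * by auto
    then have "V = W" using noncrossingD[OF NC_D(2)[OF PN] V(1) V(3)] * by metis
    then show "V' = W'" using V by simp
  qed
  ultimately show ?thesis unfolding NC_def by simp
qed

text \<open>A new crossing \<open>a < b < c < d\<close> must have \<open>d = Suc n\<close>, with
  \<open>b\<close> in the block of 1. Then either \<open>a = 1\<close> and the blocks agree, or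
  \<open>1 < a < b < c\<close> is a crossing already present in \<open>P\<close>.\<close>

lemma close_up_NC_irr:
  assumes n: "1 \<le> n" and P: "P \<in> NC n"
  shows "close_up (Suc n) P \<in> NC_irr (Suc n)"
proof -
  note eq = partition_on_block_eq[OF NC_D(1)[OF P]]
  have U: "\<Union>P = {1..n}" using NC_D(1)[OF P] unfolding partition_on_def by simp
  have notin: "Suc n \<notin> V" if "V \<in> P" for V using NC_block_subset[OF P that] by auto
  obtain B where B: "B \<in> P" "1 \<in> B" using U n by (metis Union_iff atLeastAtMost_iff order_refl)
  define g where "g V = (if 1 \<in> V then insert (Suc n) V else V)" for V :: "nat set"
  have g: "close_up (Suc n) P = g ` P" unfolding close_up_def g_def by simp
  have mem: "x \<in> g V \<longleftrightarrow> x \<in> V \<or> x = Suc n \<and> 1 \<in> V" for x V unfolding g_def by auto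
  have geq: "V = W" if "V \<in> P" "W \<in> P" "x \<in> g V" "x \<in> g W" for V W x
    using that eq notin unfolding mem by metis
  have "partition_on {1..Suc n} (g ` P)"
  proof (rule partition_onI_eq)
    have "\<Union>(g ` P) = insert (Suc n) (\<Union>P)"
    proof (rule set_eqI)
      fix x show "x \<in> \<Union>(g ` P) \<longleftrightarrow> x \<in> insert (Suc n) (\<Union>P)" using B mem by auto
    qed
    also have "\<dots> = {1..Suc n}" unfolding U by auto
    finally show "\<Union>(g ` P) = {1..Suc n}" .
    show "{} \<notin> g ` P" using NC_block(2)[OF P] unfolding g_def by (auto split: if_splits)
    show "V = W" if "V \<in> g ` P" "W \<in> g ` P" "x \<in> V" "x \<in> W" for V W x
      using that geq by blast
  qed
  moreover have "noncrossing (g ` P)"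
  proof (rule noncrossingI)
    fix V' W' a b c d
    assume "V' \<in> g ` P" "W' \<in> g ` P"
      and *: "a \<in> V'" "b \<in> W'" "c \<in> V'" "d \<in> W'" and less: "a < b" "b < c" "c < d"
    then obtain V W where V: "V \<in> P" "V' = g V" "W \<in> P" "W' = g W" by blast
    have le: "x \<le> Suc n" if "x \<in> g X" "X \<in> P" for x X
      using that NC_block_subset[OF P that(2)] unfolding mem by auto
    have "d \<le> Suc n" using le * V by blast
    then have abc: "a \<in> V" "b \<in> W" "c \<in> V" using *[unfolded V(2,4)] less unfolding mem by auto
    have "V = W"
    proof (cases "d \<in> W")
      case True
      then show ?thesis using noncrossingD[OF NC_D(2)[OF P] V(1) V(3) abc] less by metis
    next
      case False
      then have W: "1 \<in> W" using *[unfolded V(2,4)] unfolding mem by auto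
      have "1 \<le> a" using abc(1) NC_block_subset[OF P V(1)] by auto
      show ?thesis
      proof (cases "a = 1")
        case True
        then show ?thesis using eq[OF V(1) V(3) abc(1)] W by simp
      next
        case False
        then have "1 < a" using \<open>1 \<le> a\<close> by simp
        then show ?thesis
          using noncrossingD[OF NC_D(2)[OF P] V(3) V(1) W abc] less by metis
      qed
    qed
    then show "V' = W'" using V by simp
  qed
  ultimately have "g ` P \<in> NC (Suc n)" unfolding NC_def by simp
  moreover have "1 \<in> g B" "Suc n \<in> g B" "g B \<in> g ` P" using B mem by auto
  ultimately show ?thesis unfolding g NC_irr_iff[of "Suc n", simplified] by auto
qed

text \<open>The case \<open>n = 0\<close> is computed directly, since deleting 1 from
  \<open>{{1}}\<close> would leave an empty block.\<close>

lemma card_NC_irr_Suc: "card (NC_irr (Suc n)) = card (NC n)"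
proof (cases "n = 0")
  case True
  have "partition_on {1..1} P \<longleftrightarrow> P = {{1}}" for P :: "nat set set"
  proof
    assume P: "partition_on {1..1} P"
    then have U: "\<Union>P = {1}" "{} \<notin> P" unfolding partition_on_def by simp_all
    have "V = {1}" if "V \<in> P" for V using that U by (metis Union_upper subset_singletonD)
    moreover have "P \<noteq> {}" using U(1) by blast
    ultimately have "P \<subseteq> {{1}}" "P \<noteq> {}" by blast+
    then show "P = {{1}}" by blast
  qed (simp add: partition_on_space)
  moreover have "noncrossing {{1::nat}}" unfolding noncrossing_def by simp
  ultimately have "NC_irr 1 = {{{1}}}" using NC_irr_iff[of 1] unfolding NC_def by auto
  moreover have "NC 0 = {{}}" unfolding NC_def by (auto simp: partition_on_empty noncrossing_def)
  ultimately show ?thesis using True by simp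
next
  case False
  then have n: "1 \<le> n" by simp
  have "bij_betw (delete_point (Suc n)) (NC_irr (Suc n)) (NC n)"
  proof (rule bij_betw_byWitness[where f' = "close_up (Suc n)"])
    show "\<forall>P\<in>NC_irr (Suc n). close_up (Suc n) (delete_point (Suc n) P) = P"
    proof
      fix P assume "P \<in> NC_irr (Suc n)"
      then obtain B where P: "P \<in> NC (Suc n)" and B: "B \<in> P" "1 \<in> B" "Suc n \<in> B"
        using NC_irr_iff[of "Suc n" P] by auto
      have "(if 1 \<in> V - {Suc n} then insert (Suc n) (V - {Suc n}) else V - {Suc n}) = V"
        if V: "V \<in> P" for V
      proof -
        have "1 \<in> V \<longleftrightarrow> Suc n \<in> V"
          using partition_on_block_eq[OF NC_D(1)[OF P] V B(1)] B by metis
        then show ?thesis using n by auto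
      qed
      then show "close_up (Suc n) (delete_point (Suc n) P) = P"
        unfolding close_up_def delete_point_def image_image by simp
    qed
    show "\<forall>P\<in>NC n. delete_point (Suc n) (close_up (Suc n) P) = P"
    proof
      fix P assume P: "P \<in> NC n"
      have "(if 1 \<in> V then insert (Suc n) V else V) - {Suc n} = V" if V: "V \<in> P" for V
        using NC_block_subset[OF P V] by auto
      then show "delete_point (Suc n) (close_up (Suc n) P) = P"
        unfolding close_up_def delete_point_def image_image by simp
    qed
    show "delete_point (Suc n) ` NC_irr (Suc n) \<subseteq> NC n" using delete_point_NC[OF n] by blast
    show "close_up (Suc n) ` NC n \<subseteq> NC_irr (Suc n)" using close_up_NC_irr[OF n] by blast
  qed
  then show ?thesis by (rule bij_betw_same_card)
qed

section \<open>Noncrossing partitions of other ground sets\<close>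

definition NC_on :: "nat set \<Rightarrow> nat set set set" where
  "NC_on A = {P. partition_on A P \<and> noncrossing P}"

text \<open>A strictly monotone map is injective and reflects the order on \<open>A\<close>, so a
  crossing of image blocks comes from a crossing in \<open>P\<close>.\<close>

lemma NC_on_image:
  assumes P: "P \<in> NC_on A" and f: "strict_mono_on A f"
  shows "(`) f ` P \<in> NC_on (f ` A)"
proof -
  have part: "partition_on A P" and nc: "noncrossing P" using P unfolding NC_on_def by auto
  have inj: "inj_on f A" using f by (rule strict_mono_on_imp_inj_on)
  have sub: "V \<subseteq> A" if "V \<in> P" for V using part that unfolding partition_on_def by auto
  have "{} \<notin> (`) f ` P" using part unfolding partition_on_def by auto
  then have "partition_on (f ` A) ((`) f ` P)"
    using partition_on_inj_image[OF part inj] by simp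
  moreover have "noncrossing ((`) f ` P)"
  proof (rule noncrossingI)
    fix V' W' a' b' c' d'
    assume "V' \<in> (`) f ` P" "W' \<in> (`) f ` P"
      and *: "a' \<in> V'" "b' \<in> W'" "c' \<in> V'" "d' \<in> W'" and less: "a' < b'" "b' < c'" "c' < d'"
    then obtain V W where V: "V \<in> P" "V' = f ` V" "W \<in> P" "W' = f ` W" by blast
    then obtain a b c d where mem: "a \<in> V" "b \<in> W" "c \<in> V" "d \<in> W"
      and eq: "a' = f a" "b' = f b" "c' = f c" "d' = f d"
      using * by blast
    have A: "a \<in> A" "b \<in> A" "c \<in> A" "d \<in> A" using mem V sub by blast+
    have "x < y" if "f x < f y" "x \<in> A" "y \<in> A" for x y
    proof (rule ccontr)
      assume "\<not> x < y"
      then have "f y \<le> f x"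
        using that strict_mono_onD[OF f, of y x] by (cases "x = y") (auto simp: not_less)
      then show False using that by simp
    qed
    then have "a < b" "b < c" "c < d" using less A unfolding eq by auto
    then have "V = W" using noncrossingD[OF nc V(1) V(3) mem] by blast
    then show "V' = W'" using V by simp
  qed
  ultimately show ?thesis unfolding NC_on_def by simp
qed

lemma card_NC_on_shift: "card (NC_on {Suc m..m + n}) = card (NC n)"
proof -
  have up: "(\<lambda>x. x + m) ` {1..n} = {Suc m..m + n}"
    by (simp add: image_add_atLeastAtMost' add.commute)
  have down: "(\<lambda>x. x - m) ` {Suc m..m + n} = {1..n}"
    unfolding up[symmetric] image_image by simp
  have "bij_betw (\<lambda>P. (`) (\<lambda>x. x + m) ` P) (NC_on {1..n}) (NC_on {Suc m..m + n})"
  proof (rule bij_betw_byWitness[where f' = "\<lambda>P. (`) (\<lambda>x. x - m) ` P"])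
    show "\<forall>P\<in>NC_on {1..n}. (`) (\<lambda>x. x - m) ` (`) (\<lambda>x. x + m) ` P = P"
      by (simp add: image_image)
    show "\<forall>P\<in>NC_on {Suc m..m + n}. (`) (\<lambda>x. x + m) ` (`) (\<lambda>x. x - m) ` P = P"
    proof
      fix P assume "P \<in> NC_on {Suc m..m + n}"
      then have sub: "V \<subseteq> {Suc m..m + n}" if "V \<in> P" for V
        using that unfolding NC_on_def partition_on_def by auto
      \<comment> \<open>All points exceed \<open>m\<close>, so the truncated subtraction is
        exact.\<close>
      have "(\<lambda>x. x - m + m) ` V = V" if "V \<in> P" for V
      proof -
        have "(\<lambda>x. x - m + m) ` V = id ` V"
          using sub[OF that] by (intro image_cong) auto
        then show ?thesis by simp
      qed
      then show "(`) (\<lambda>x. x + m) ` (`) (\<lambda>x. x - m) ` P = P" by (simp add: image_image)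
    qed
    show "(\<lambda>P. (`) (\<lambda>x. x + m) ` P) ` NC_on {1..n} \<subseteq> NC_on {Suc m..m + n}"
    proof (rule image_subsetI)
      fix P assume "P \<in> NC_on {1..n}"
      then show "(`) (\<lambda>x. x + m) ` P \<in> NC_on {Suc m..m + n}"
        using NC_on_image[of P "{1..n}" "\<lambda>x. x + m"] unfolding up
        by (simp add: strict_mono_on_def)
    qed
    show "(\<lambda>P. (`) (\<lambda>x. x - m) ` P) ` NC_on {Suc m..m + n} \<subseteq> NC_on {1..n}"
    proof (rule image_subsetI)
      fix P assume "P \<in> NC_on {Suc m..m + n}"
      moreover have "strict_mono_on {Suc m..m + n} (\<lambda>x. x - m)"
        by (rule strict_mono_onI) auto
      ultimately show "(`) (\<lambda>x. x - m) ` P \<in> NC_on {1..n}"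
        using NC_on_image[of P "{Suc m..m + n}" "\<lambda>x. x - m"] unfolding down by simp
    qed
  qed
  then have "card (NC_on {1..n}) = card (NC_on {Suc m..m + n})" by (rule bij_betw_same_card)
  then show ?thesis unfolding NC_def NC_on_def by simp
qed

lemma NC_eq_NC_on: "NC n = NC_on {1..n}"
  unfolding NC_def NC_on_def by simp

lemma finite_NC_on: "finite A \<Longrightarrow> finite (NC_on A)"
  unfolding NC_on_def by (rule finite_subset[OF _ finitely_many_partition_on]) auto

text \<open>A crossing alternates between its two blocks, which is impossible when one block lies
  entirely to the left of the other.\<close>

lemma NC_on_union:
  assumes P: "P \<in> NC_on A" and Q: "Q \<in> NC_on B" and less: "\<And>a b. a \<in> A \<Longrightarrow> b \<in> B \<Longrightarrow> a < b"
  shows "P \<union> Q \<in> NC_on (A \<union> B)"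
proof -
  have part: "partition_on A P" "partition_on B Q" and nc: "noncrossing P" "noncrossing Q"
    using P Q unfolding NC_on_def by auto
  have subP: "V \<subseteq> A" if "V \<in> P" for V using part that unfolding partition_on_def by auto
  have subQ: "V \<subseteq> B" if "V \<in> Q" for V using part that unfolding partition_on_def by auto
  have cross: "x < y" if "V \<in> P" "x \<in> V" "W \<in> Q" "y \<in> W" for V W x y
    using that subP subQ less by blast
  have "partition_on (A \<union> B) (P \<union> Q)"
  proof (rule partition_onI_eq)
    show "\<Union>(P \<union> Q) = A \<union> B" "{} \<notin> P \<union> Q" using part unfolding partition_on_def by auto
    show "V = W" if "V \<in> P \<union> Q" "W \<in> P \<union> Q" "x \<in> V" "x \<in> W" for V W x
      using that cross[of V x W x] cross[of W x V x]
        partition_on_block_eq[OF part(1), of V W x] partition_on_block_eq[OF part(2), of V W x]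
      by blast
  qed
  moreover have "noncrossing (P \<union> Q)"
  proof (rule noncrossingI)
    fix V W a b c d
    assume *: "V \<in> P \<union> Q" "W \<in> P \<union> Q"
      and mem: "a \<in> V" "b \<in> W" "c \<in> V" "d \<in> W" and lt: "a < b" "b < c" "c < d"
    have "\<not> (V \<in> P \<and> W \<in> Q)" "\<not> (W \<in> P \<and> V \<in> Q)"
      using cross[of V c W b] cross[of W b V a] mem lt by auto
    then consider "V \<in> P" "W \<in> P" | "V \<in> Q" "W \<in> Q" using * by blast
    then show "V = W"
      using noncrossingD[OF nc(1) _ _ mem lt] noncrossingD[OF nc(2) _ _ mem lt] by cases
  qed
  ultimately show ?thesis unfolding NC_on_def by simp
qed

lemma finite_NC: "finite (NC n)"
  unfolding NC_eq_NC_on by (rule finite_NC_on) simp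

section \<open>Cutting after the block of 1\<close>

text \<open>The partitions of \<open>[n + 1]\<close> in which the block of \<open>1\<close> ends at \<open>k + 1\<close>.\<close>

definition gluing :: "nat \<Rightarrow> nat \<Rightarrow> nat set set set" where
  "gluing n k = (\<lambda>(P, Q). P \<union> Q) ` (NC_irr (Suc k) \<times> NC_on {Suc (Suc k)..Suc n})"

lemma gluing_subset_NC:
  assumes k: "k \<le> n"
  shows "gluing n k \<subseteq> NC (Suc n)"
proof
  fix R assume "R \<in> gluing n k"
  then obtain P Q where PQ: "P \<in> NC_irr (Suc k)" "Q \<in> NC_on {Suc (Suc k)..Suc n}" "R = P \<union> Q"
    unfolding gluing_def by auto
  then have "P \<in> NC_on {1..Suc k}" unfolding NC_irr_def NC_eq_NC_on by simp
  then have "R \<in> NC_on ({1..Suc k} \<union> {Suc (Suc k)..Suc n})"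
    unfolding PQ(3) by (rule NC_on_union[OF _ PQ(2)]) auto
  moreover have "{1..Suc k} \<union> {Suc (Suc k)..Suc n} = {1..Suc n}" using k by auto
  ultimately show "R \<in> NC (Suc n)" unfolding NC_eq_NC_on by simp
qed

text \<open>Shows that \<open>k\<close> can be read off from a glued partition, which makes the
  gluings for different \<open>k\<close> disjoint.\<close>

lemma gluing_Max:
  assumes k: "k \<le> n" and R: "R \<in> gluing n k" and B: "B \<in> R" "1 \<in> B"
  shows "Max B = Suc k"
proof -
  obtain P Q where PQ: "P \<in> NC_irr (Suc k)" "Q \<in> NC_on {Suc (Suc k)..Suc n}" "R = P \<union> Q"
    using R unfolding gluing_def by auto
  obtain V where P: "P \<in> NC (Suc k)" and V: "V \<in> P" "1 \<in> V" "Suc k \<in> V"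
    using PQ(1) NC_irr_iff[of "Suc k" P] by auto
  have "R \<in> NC (Suc n)" using gluing_subset_NC[OF k] R by blast
  from NC_D(1)[OF this] have "B = V"
    by (rule partition_on_block_eq[OF _ B(1) _ B(2) V(2)]) (use V(1) PQ(3) in blast)
  moreover have "Max V = Suc k"
    using NC_block_subset[OF P V(1)] NC_block(1)[OF P V(1)] V(3) by (intro Max_eqI) auto
  ultimately show ?thesis by simp
qed

text \<open>A glued partition determines its two parts: the blocks inside \<open>{1..Suc k}\<close>
  form \<open>P\<close>, and those of \<open>Q\<close>, being nonempty, are not inside it.\<close>

lemma card_gluing:
  assumes k: "k \<le> n"
  shows "card (gluing n k) = card (NC k) * card (NC (n - k))"
proof -
  have split: "P = {V \<in> P \<union> Q. V \<subseteq> {1..Suc k}} \<and> Q = {V \<in> P \<union> Q. \<not> V \<subseteq> {1..Suc k}}"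
    if P: "P \<in> NC_irr (Suc k)" and Q: "Q \<in> NC_on {Suc (Suc k)..Suc n}" for P Q
  proof -
    have "P \<in> NC (Suc k)" using P unfolding NC_irr_def by simp
    then have "\<forall>V\<in>P. V \<subseteq> {1..Suc k}" using NC_block_subset by blast
    moreover have "\<not> V \<subseteq> {1..Suc k}" if V: "V \<in> Q" for V
    proof -
      have "V \<noteq> {}" "V \<subseteq> {Suc (Suc k)..Suc n}"
        using V Q unfolding NC_on_def partition_on_def by auto
      then show ?thesis by fastforce
    qed
    ultimately show ?thesis by blast
  qed
  have "inj_on (\<lambda>(P, Q). P \<union> Q) (NC_irr (Suc k) \<times> NC_on {Suc (Suc k)..Suc n})"
  proof (rule inj_onI, clarify)
    fix P Q P' Q'
    assume "P \<in> NC_irr (Suc k)" "Q \<in> NC_on {Suc (Suc k)..Suc n}"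
      "P' \<in> NC_irr (Suc k)" "Q' \<in> NC_on {Suc (Suc k)..Suc n}" and eq: "P \<union> Q = P' \<union> Q'"
    then show "P = P' \<and> Q = Q'" using split[of P Q] split[of P' Q'] by metis
  qed
  then have "card (gluing n k) = card (NC_irr (Suc k)) * card (NC_on {Suc (Suc k)..Suc n})"
    unfolding gluing_def by (simp add: card_image card_cartesian_product)
  \<comment> \<open>The shape expected by \<open>card_NC_on_shift\<close>, with \<open>Suc k\<close>
    as the shift and \<open>n - k\<close> points.\<close>
  moreover have "{Suc (Suc k)..Suc n} = {Suc (Suc k)..Suc k + (n - k)}" using k by simp
  ultimately show ?thesis
    by (simp only: card_NC_irr_Suc card_NC_on_shift)
qed

lemma NC_Suc_gluing: "NC (Suc n) = (\<Union>k\<le>n. gluing n k)"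
proof
  show "(\<Union>k\<le>n. gluing n k) \<subseteq> NC (Suc n)" using gluing_subset_NC by blast
  show "NC (Suc n) \<subseteq> (\<Union>k\<le>n. gluing n k)"
  proof
    fix R assume R: "R \<in> NC (Suc n)"
    have part: "partition_on {1..Suc n} R" and nc: "noncrossing R" using NC_D[OF R] by auto
    have U: "\<Union>R = {1..Suc n}" using part unfolding partition_on_def by simp
    have "1 \<in> \<Union>R" unfolding U by simp
    then obtain B where B: "B \<in> R" "1 \<in> B" by blast
    have Bsub: "B \<subseteq> {1..Suc n}" and finB: "finite B"
      using NC_block_subset[OF R B(1)] NC_block[OF R B(1)] by auto
    have MB: "Max B \<in> B" using finB B(2) by (intro Max_in) auto
    \<comment> \<open>\<open>Max B\<close> is at least 1, so this subtraction is exact.\<close>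
    define k where "k = Max B - 1"
    have k: "Max B = Suc k" "k \<le> n" using MB Bsub by (auto simp: k_def subset_iff)
    define P where "P = {V \<in> R. V \<subseteq> {1..Suc k}}"
    define Q where "Q = {V \<in> R. V \<subseteq> {Suc (Suc k)..Suc n}}"
    have BP: "B \<in> P" unfolding P_def using B(1) Bsub Max_ge[OF finB] k(1) by auto
    \<comment> \<open>A block on both sides of the cut would differ from \<open>B\<close>, hence
      avoid 1 and \<open>Suc k\<close>, and have points \<open>1 < x < Suc k < y\<close> that cross
      \<open>B\<close>.\<close>
    have split: "V \<in> P \<or> V \<in> Q" if V: "V \<in> R" for V
    proof (rule ccontr)
      assume contra: "\<not> (V \<in> P \<or> V \<in> Q)"
      have Vsub: "V \<subseteq> {1..Suc n}" using NC_block_subset[OF R V] .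
      have "V \<noteq> B" using contra BP by blast
      then have ne: "1 \<notin> V" "Suc k \<notin> V"
        using partition_on_block_eq[OF part V B(1)] B(2) MB k(1) by metis+
      obtain x where x: "x \<in> V" "x \<notin> {Suc (Suc k)..Suc n}" using contra V unfolding Q_def by blast
      obtain y where y: "y \<in> V" "y \<notin> {1..Suc k}" using contra V unfolding P_def by blast
      have "1 < x" "x < Suc k" using x Vsub ne
        by (metis atLeastAtMost_iff le_neq_implies_less subsetD,
            metis atLeastAtMost_iff subsetD not_less_eq_eq le_neq_implies_less)
      moreover have "Suc k < y" using y Vsub by auto
      ultimately have "B = V"
        using noncrossingD[OF nc B(1) V B(2) x(1) _ y(1)] MB k(1) by metis
      then show False using \<open>V \<noteq> B\<close> by simp
    qed
    have RPQ: "R = P \<union> Q" using split unfolding P_def Q_def by blast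
    have sub: "P \<subseteq> R" "Q \<subseteq> R" unfolding P_def Q_def by auto
    have "partition_on {1..Suc k} P"
    proof (rule partition_onI_eq)
      show "\<Union>P = {1..Suc k}"
      proof
        show "\<Union>P \<subseteq> {1..Suc k}" unfolding P_def by blast
        show "{1..Suc k} \<subseteq> \<Union>P"
        proof
          fix x assume x: "x \<in> {1..Suc k}"
          then have "x \<in> \<Union>R" unfolding U using k(2) by auto
          then obtain V where V: "V \<in> R" "x \<in> V" by blast
          then have "V \<notin> Q" using x unfolding Q_def by auto
          then show "x \<in> \<Union>P" using V split by blast
        qed
      qed
      show "{} \<notin> P" using part sub unfolding partition_on_def by blast
      show "V = W" if "V \<in> P" "W \<in> P" "x \<in> V" "x \<in> W" for V W x
        using partition_on_block_eq[OF part] that sub by blast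
    qed
    then have "P \<in> NC (Suc k)" using noncrossing_subset[OF nc sub(1)] unfolding NC_def by simp
    \<comment> \<open>\<open>B\<close> is a block of \<open>P\<close> containing both 1 and
      \<open>Suc k\<close>.\<close>
    then have "P \<in> NC_irr (Suc k)" using NC_irr_iff[of "Suc k" P] BP B(2) MB k(1) by auto
    moreover have "Q \<in> NC_on {Suc (Suc k)..Suc n}"
    proof -
      have "partition_on {Suc (Suc k)..Suc n} Q"
      proof (rule partition_onI_eq)
        show "\<Union>Q = {Suc (Suc k)..Suc n}"
        proof
          show "\<Union>Q \<subseteq> {Suc (Suc k)..Suc n}" unfolding Q_def by blast
          show "{Suc (Suc k)..Suc n} \<subseteq> \<Union>Q"
          proof
            fix x assume x: "x \<in> {Suc (Suc k)..Suc n}"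
            then have "x \<in> \<Union>R" unfolding U by auto
            then obtain V where V: "V \<in> R" "x \<in> V" by blast
            then have "V \<notin> P" using x unfolding P_def by auto
            then show "x \<in> \<Union>Q" using V split by blast
          qed
        qed
        show "{} \<notin> Q" using part sub unfolding partition_on_def by blast
        show "V = W" if "V \<in> Q" "W \<in> Q" "x \<in> V" "x \<in> W" for V W x
          using partition_on_block_eq[OF part] that sub by blast
      qed
      then show ?thesis using noncrossing_subset[OF nc sub(2)] unfolding NC_on_def by simp
    qed
    ultimately have "R \<in> gluing n k" unfolding gluing_def RPQ by auto
    then show "R \<in> (\<Union>k\<le>n. gluing n k)" using k(2) by blast
  qed
qed

lemma card_NC_Suc: "card (NC (Suc n)) = (\<Sum>k\<le>n. card (NC k) * card (NC (n - k)))"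
proof -
  have fin: "finite (gluing n k)" if "k \<le> n" for k
    using gluing_subset_NC[OF that] finite_NC by (rule finite_subset)
  have disj: "gluing n i \<inter> gluing n j = {}" if "i \<le> n" "j \<le> n" "i \<noteq> j" for i j
  proof (rule ccontr)
    assume "gluing n i \<inter> gluing n j \<noteq> {}"
    then obtain R where R: "R \<in> gluing n i" "R \<in> gluing n j" by blast
    then have "R \<in> NC (Suc n)" using gluing_subset_NC[OF that(1)] by blast
    then have "\<Union>R = {1..Suc n}" using NC_D(1) unfolding partition_on_def by blast
    then have "1 \<in> \<Union>R" by simp
    then obtain B where "B \<in> R" "1 \<in> B" by blast
    then have "Suc i = Suc j" using gluing_Max that R by metis
    then show False using that by simp
  qed
  have "card (NC (Suc n)) = (\<Sum>k\<le>n. card (gluing n k))"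
    unfolding NC_Suc_gluing using fin disj by (intro card_UN_disjoint) auto
  then show ?thesis by (simp add: card_gluing)
qed

text \<open>Both sides satisfy the same convolution recurrence with the same start; the recurrence
  uses all smaller indices, hence the strong induction.\<close>

lemma card_NC: "real (card (NC n)) = catalan n"
proof (induction n rule: less_induct)
  case (less n)
  show ?case
  proof (cases n)
    case 0
    have "NC 0 = {{}}" unfolding NC_def by (auto simp: partition_on_empty noncrossing_def)
    then show ?thesis using 0 by (simp add: catalan_0)
  next
    case (Suc m)
    have "real (card (NC n)) = (\<Sum>k\<le>m. real (card (NC k)) * real (card (NC (m - k))))"
      unfolding Suc card_NC_Suc by simp
    also have "\<dots> = (\<Sum>k\<le>m. catalan k * catalan (m - k))"
      using less.IH Suc by (intro sum.cong) auto
    finally show ?thesis unfolding Suc catalan_convolution .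
  qed
qed

section \<open>Disjointness, the two bijections and the Catalan sum\<close>

theorem proposition7p1:
  shows "disjoint_family_on adapted (\<Union>n. motzkin_words n)
    \<and> disjoint_family_on adapted_irr (\<Union>n. motzkin_words n)
    \<and> (\<forall>n\<ge>1.
        (\<exists>\<phi>. bij_betw \<phi> (NC n) (\<Union>w\<in>motzkin_words n. adapted w)
           \<and> (\<forall>Q \<in> (\<Union>w\<in>motzkin_words n. adapted w). inv_into (NC n) \<phi> Q = forget_words Q))
      \<and> (\<exists>\<phi>. bij_betw \<phi> (NC_irr n) (\<Union>w\<in>motzkin_words n. adapted_irr w)
           \<and> (\<forall>Q \<in> (\<Union>w\<in>motzkin_words n. adapted_irr w). inv_into (NC_irr n) \<phi> Q = forget_words Q))
      \<and> catalan n = (\<Sum>w\<in>motzkin_words (n + 1). real (card (adapted_irr w))))"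
proof (intro conjI allI impI)
  have sub: "adapted_irr w \<subseteq> adapted w" for w unfolding adapted_irr_def by blast
  have disj: "adapted w \<inter> adapted w' = {}" "adapted_irr w \<inter> adapted_irr w' = {}" if "w \<noteq> w'" for w w'
    using adapted_word_unique[of _ w w'] that sub[of w] sub[of w'] by blast+
  show "disjoint_family_on adapted (\<Union>n. motzkin_words n)"
    "disjoint_family_on adapted_irr (\<Union>n. motzkin_words n)"
    unfolding disjoint_family_on_def using disj by simp_all
  have len: "length w = n" if "w \<in> motzkin_words n" for w n
    using that unfolding motzkin_words_def by simp
  \<comment> \<open>Specialises the target of \<open>bij_betw_forget_words\<close>: for
    \<open>NC n\<close> the condition on the partition is automatic, for \<open>NC_irr n\<close> it
    is the one defining \<open>adapted_irr\<close>.\<close>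
  have T: "(\<Union>w\<in>motzkin_words n. {Q \<in> adapted w. forget_words Q \<in> NC n})
      = (\<Union>w\<in>motzkin_words n. adapted w)" for n
    using len by (auto simp: adapted_iff)
  have T_irr: "(\<Union>w\<in>motzkin_words n. {Q \<in> adapted w. forget_words Q \<in> NC_irr n})
      = (\<Union>w\<in>motzkin_words n. adapted_irr w)" for n
    using len by (auto simp: adapted_irr_def)
  have irr_sub: "NC_irr n \<subseteq> NC n" for n unfolding NC_irr_def by blast
  fix n :: nat assume n: "1 \<le> n"
  show "\<exists>\<phi>. bij_betw \<phi> (NC n) (\<Union>w\<in>motzkin_words n. adapted w)
      \<and> (\<forall>Q \<in> (\<Union>w\<in>motzkin_words n. adapted w). inv_into (NC n) \<phi> Q = forget_words Q)"
    using bij_betw_forget_words[OF n order_refl] inv_into_bij_betw_forget_words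
    unfolding T by blast
  show "\<exists>\<phi>. bij_betw \<phi> (NC_irr n) (\<Union>w\<in>motzkin_words n. adapted_irr w)
      \<and> (\<forall>Q \<in> (\<Union>w\<in>motzkin_words n. adapted_irr w). inv_into (NC_irr n) \<phi> Q = forget_words Q)"
    using bij_betw_forget_words[OF n irr_sub] inv_into_bij_betw_forget_words
    unfolding T_irr by blast
  \<comment> \<open>Deleting the last point shifts the index by one, which is why words of length
    \<open>n + 1\<close> appear in the sum.\<close>
  have "catalan n = real (card (NC_irr (n + 1)))"
    using card_NC card_NC_irr_Suc by simp
  also have "\<dots> = real (card (\<Union>w\<in>motzkin_words (n + 1). adapted_irr w))"
    using bij_betw_same_card[OF bij_betw_forget_words[OF _ irr_sub[of "n + 1"]]]
    unfolding T_irr by simp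
  also have "card (\<Union>w\<in>motzkin_words (n + 1). adapted_irr w)
      = (\<Sum>w\<in>motzkin_words (n + 1). card (adapted_irr w))"
    using finite_motzkin_words finite_subset[OF sub finite_adapted] disj
    by (intro card_UN_disjoint) auto
  finally show "catalan n = (\<Sum>w\<in>motzkin_words (n + 1). real (card (adapted_irr w)))"
    by simp
qed

end
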